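(* If $J$ is an ideal on $\omega$ with the Baire property, then $\mathcal{N}_J=\mathcal{N}$ and $\mathcal{N}^*_J=\mathcal{E}$.
   Context: An ideal on $\omega$ is a family $J\subseteq\mathcal{P}(\omega)$ closed under subsets and finite unions, containing all finite sets, with $\omega\notin J$; it is viewed as a subset of $\mathcal{P}(\omega)\cong{}^\omega2$ for topological notions such as the Baire property. $J^+=\mathcal{P}(\omega)\setminus J$, $J^d=\{\omega\setminus a:a\in J\}$. ${}^\omega2$ carries the Lebesgue (product) measure $\mu$; $\Omega$ is the set of its clopen subsets. For $\bar c\in{}^\omega\Omega$, $N(\bar c)=\{x:x\in c_n\text{ for infinitely many }n\}$; $\overline{\Omega}=\{\bar c\in{}^\omega\Omega:\mu(N(\bar c))=0\}$; $N_J(\bar c)=\{x:\{n:x\in c_n\}\in J^+\}$, $N^*_J(\bar c)=\{x:\{n:x\in c_n\}\in J^d\}$; $\mathcal{N}_J=\{X\subseteq{}^\omega2:\exists\bar c\in\overline{\Omega}\ X\subseteq N_J(\bar c)\}$, $\mathcal{N}^*_J=\{X:\exists\bar c\in\overline{\Omega}\ X\subseteq N^*_J(\bar c)\}$. $\mathcal{N}$ is the ideal of Lebesgue null subsets of ${}^\omega2$ and $\mathcal{E}$ is the $\sigma$-ideal generated by closed null subsets of ${}^\omega2$. *)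

theory Defs
  imports "HOL-Probability.Probability"
begin

instance bool :: second_countable_topology
proof
  show "\<exists>B::bool set set. countable B \<and> open = generate_topology B"
    by (intro exI[of _ UNIV])
      (auto simp: fun_eq_iff discrete_topology_class.open_discrete intro: generate_topology.Basis)
qed

type_synonym cantor = "nat \<Rightarrow> bool"

text \<open>The type \<^typ>\<open>cantor\<close> carries the product topology of discrete spaces through the
  type class instances for \<^typ>\<open>bool\<close> and functions.\<close>

definition cantor_measure :: "cantor measure" where
  "cantor_measure = (\<Pi>\<^sub>M n\<in>UNIV. measure_pmf (bernoulli_pmf (1/2)))"

lemma sets_cantor_measure: "sets cantor_measure = sets borel"
proof -
  have "A \<in> sets borel" for A :: "bool set"
    by (intro borel_open discrete_topology_class.open_discrete)
  then have "sets (measure_pmf (bernoulli_pmf (1/2))) = sets (borel :: bool measure)"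
    by auto
  then have "sets cantor_measure = sets (\<Pi>\<^sub>M n\<in>(UNIV::nat set). (borel :: bool measure))"
    unfolding cantor_measure_def by (intro sets_PiM_cong) auto
  then show ?thesis
    by (simp add: sets_PiM_equal_borel)
qed

definition nowhere_dense :: "'a::topological_space set \<Rightarrow> bool" where
  "nowhere_dense A \<longleftrightarrow> interior (closure A) = {}"

definition meagre :: "'a::topological_space set \<Rightarrow> bool" where
  "meagre A \<longleftrightarrow> (\<exists>F :: nat \<Rightarrow> 'a set. (\<forall>n. nowhere_dense (F n)) \<and> A = (\<Union>n. F n))"

definition baire_property :: "'a::topological_space set \<Rightarrow> bool" where
  "baire_property A \<longleftrightarrow> (\<exists>U. open U \<and> meagre (sym_diff A U))"

definition ideal_on_omega :: "nat set set \<Rightarrow> bool" where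
  "ideal_on_omega J \<longleftrightarrow>
     (\<forall>a b. a \<in> J \<longrightarrow> b \<subseteq> a \<longrightarrow> b \<in> J) \<and>
     (\<forall>a b. a \<in> J \<longrightarrow> b \<in> J \<longrightarrow> a \<union> b \<in> J) \<and>
     (\<forall>a. finite a \<longrightarrow> a \<in> J) \<and>
     UNIV \<notin> J"

text \<open>Identification of a family of subsets of \<open>\<omega>\<close> with the set of characteristic functions.\<close>
definition char_funs :: "nat set set \<Rightarrow> cantor set" where
  "char_funs J = (\<lambda>a n. n \<in> a) ` J"

definition positive_sets :: "nat set set \<Rightarrow> nat set set" where
  "positive_sets J = - J"

definition dual_filter :: "nat set set \<Rightarrow> nat set set" where
  "dual_filter J = {- a | a. a \<in> J}"

definition Omega :: "cantor set set" where
  "Omega = {c. open c \<and> closed c}"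

definition N_inf :: "(nat \<Rightarrow> cantor set) \<Rightarrow> cantor set" where
  "N_inf c = {x. infinite {n. x \<in> c n}}"

text \<open>The set \<^term>\<open>N_inf c\<close> is Borel for clopen \<^term>\<open>c n\<close>, so that membership in \<^const>\<open>null_sets\<close>
  just says that its measure vanishes.\<close>
definition Omega_bar :: "(nat \<Rightarrow> cantor set) set" where
  "Omega_bar = {c. (\<forall>n. c n \<in> Omega) \<and> N_inf c \<in> null_sets cantor_measure}"

definition N_pos :: "nat set set \<Rightarrow> (nat \<Rightarrow> cantor set) \<Rightarrow> cantor set" where
  "N_pos J c = {x. {n. x \<in> c n} \<in> positive_sets J}"

definition N_dual :: "nat set set \<Rightarrow> (nat \<Rightarrow> cantor set) \<Rightarrow> cantor set" where
  "N_dual J c = {x. {n. x \<in> c n} \<in> dual_filter J}"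

definition null_mod :: "nat set set \<Rightarrow> cantor set set" where
  "null_mod J = {X. \<exists>c\<in>Omega_bar. X \<subseteq> N_pos J c}"

definition null_star_mod :: "nat set set \<Rightarrow> cantor set set" where
  "null_star_mod J = {X. \<exists>c\<in>Omega_bar. X \<subseteq> N_dual J c}"

text \<open>The completion makes every subset of a Borel null set null.\<close>
definition null_ideal :: "cantor set set" where
  "null_ideal = null_sets (completion cantor_measure)"

definition sigma_ideal :: "'a set set \<Rightarrow> bool" where
  "sigma_ideal I \<longleftrightarrow>
     (\<forall>A B. A \<in> I \<longrightarrow> B \<subseteq> A \<longrightarrow> B \<in> I) \<and>
     (\<forall>F. F \<subseteq> I \<longrightarrow> countable F \<longrightarrow> \<Union>F \<in> I)"

definition sigma_ideal_generated :: "'a set set \<Rightarrow> 'a set set" where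
  "sigma_ideal_generated G = \<Inter>{I. sigma_ideal I \<and> G \<subseteq> I}"

definition closed_null_ideal :: "cantor set set" where
  "closed_null_ideal = sigma_ideal_generated {X. closed X \<and> X \<in> null_ideal}"

end

theory Submission
  imports Defs
begin

text \<open>By the Talagrand and Jalali-Naini theorem, an ideal \<open>J\<close> with the Baire property admits a
  partition of \<open>\<omega>\<close> into finite intervals \<open>I\<^sub>n\<close> such that every set containing infinitely many
  of them is \<open>J\<close>-positive. A null set is contained in some \<open>N(c)\<close> with summable measures
  \<open>\<mu>(c\<^sub>n)\<close>; repeating \<open>c\<^sub>n\<close> along \<open>I\<^sub>n\<close> keeps \<open>N(c)\<close> and puts it inside \<open>N\<^sub>J\<close>.
  Conversely, a point of \<open>N\<^sup>*\<^sub>J(c)\<close> lies in \<open>\<Union>k\<in>I\<^sub>n. c\<^sub>k\<close> for almost all \<open>n\<close>, which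
  describes a countable union of closed subsets of the null set \<open>N(c)\<close>. An increasing union of
  closed null sets \<open>F\<^sub>n\<close> is covered using clopen \<open>c\<^sub>n \<supseteq> F\<^sub>n\<close> of measure below \<open>2\<^sup>-\<^sup>n\<close>.\<close>

section \<open>Cylinders and clopen subsets of Cantor space\<close>

definition cyl :: "cantor \<Rightarrow> nat \<Rightarrow> cantor set" where
  "cyl x n = {y. \<forall>i<n. y i = x i}"

lemma self_in_cyl [simp]: "x \<in> cyl x n"
  by (simp add: cyl_def)

lemma cyl_antimono: "m \<le> n \<Longrightarrow> cyl x n \<subseteq> cyl x m"
  by (auto simp: cyl_def)

lemma cyl_eq: "y \<in> cyl x n \<Longrightarrow> cyl y n = cyl x n"
  by (auto simp: cyl_def)

lemma open_cyl: "open (cyl x n)"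
proof -
  have "open {y. \<forall>i\<in>{..<n}. y (id i) \<in> {x i}}"
    by (rule product_topology_basis') (auto intro: discrete_topology_class.open_discrete)
  then show ?thesis
    by (simp add: cyl_def lessThan_def)
qed

text \<open>A basic open box restricts only finitely many coordinates, and \<open>n\<close> is taken
  beyond all of them.\<close>

lemma open_contains_cyl:
  assumes "open U" "x \<in> U"
  obtains n where "cyl x n \<subseteq> U"
proof -
  have "openin (product_topology (\<lambda>i. euclidean) UNIV) U"
    using assms by (simp add: open_fun_def)
  from product_topology_open_contains_basis[OF this \<open>x \<in> U\<close>]
  obtain X where X: "x \<in> (\<Pi>\<^sub>E i\<in>UNIV. X i)" "finite {i. X i \<noteq> UNIV}" "(\<Pi>\<^sub>E i\<in>UNIV. X i) \<subseteq> U"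
    by auto
  from X(2) obtain n where n: "\<And>i. X i \<noteq> UNIV \<Longrightarrow> i < n"
    using finite_nat_set_iff_bounded by auto
  have "y \<in> U" if "y \<in> cyl x n" for y
  proof -
    have "y i \<in> X i" for i
      using X(1) n[of i] that by (cases "X i = UNIV") (auto simp: cyl_def PiE_iff)
    then show ?thesis
      using X(3) by (auto simp: PiE_iff)
  qed
  then show ?thesis
    using that by blast
qed

lemma open_if_finite_support:
  assumes "\<And>x y. y \<in> cyl x n \<Longrightarrow> x \<in> D \<Longrightarrow> y \<in> D"
  shows "open D"
proof (rule Topological_Spaces.openI)
  fix x assume "x \<in> D"
  then have "cyl x n \<subseteq> D"
    using assms by (intro subsetI)
  then show "\<exists>T. open T \<and> x \<in> T \<and> T \<subseteq> D"
    by (intro exI[of _ "cyl x n"] conjI open_cyl self_in_cyl)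
qed

text \<open>Lying in a common cylinder of length \<open>n\<close> is a symmetric relation, so the
  complement of \<open>D\<close> inherits the hypothesis and is open as well.\<close>

lemma Omega_if_finite_support:
  assumes "\<And>x y. y \<in> cyl x n \<Longrightarrow> x \<in> D \<Longrightarrow> y \<in> D"
  shows "D \<in> Omega"
proof -
  have "y \<in> - D" if "y \<in> cyl x n" "x \<in> - D" for x y
    using assms[of x y] that by (auto simp: cyl_def)
  then have "open (- D)"
    by (rule open_if_finite_support)
  moreover have "open D"
    using assms by (rule open_if_finite_support)
  ultimately show ?thesis
    by (simp add: Omega_def closed_def)
qed

lemma Omega_sets: "D \<in> Omega \<Longrightarrow> D \<in> sets cantor_measure"
  by (auto simp: Omega_def sets_cantor_measure)

lemma prob_space_cantor_measure: "prob_space cantor_measure"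
  unfolding cantor_measure_def by (intro prob_space_PiM prob_space_measure_pmf)

text \<open>The set \<open>D n\<close> collects the cylinders of length \<open>n\<close> inside
  \<open>U\<close>, so it is determined by the first \<open>n\<close> coordinates. It grows because
  cylinders shrink, and it exhausts \<open>U\<close> because cylinders form a base.\<close>

lemma open_eq_increasing_clopens:
  assumes "open (U :: cantor set)"
  obtains D :: "nat \<Rightarrow> cantor set" where "\<And>n. D n \<in> Omega" "incseq D" "(\<Union>n. D n) = U"
proof
  define D where "D = (\<lambda>n. {x. cyl x n \<subseteq> U})"
  show "D n \<in> Omega" for n
    by (rule Omega_if_finite_support[of n]) (auto simp: D_def dest: cyl_eq)
  show "incseq D"
    using cyl_antimono by (fastforce simp: incseq_def D_def)
  show "(\<Union>n. D n) = U"
  proof (intro equalityI subsetI)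
    fix x assume "x \<in> U"
    then obtain n where "cyl x n \<subseteq> U"
      using open_contains_cyl[OF assms] by auto
    then have "x \<in> D n"
      by (simp add: D_def)
    then show "x \<in> (\<Union>n. D n)"
      by (rule UN_I[OF UNIV_I])
  next
    fix x assume "x \<in> (\<Union>n. D n)"
    then show "x \<in> U"
      using self_in_cyl[of x] by (auto simp: D_def)
  qed
qed

lemma closed_eq_decreasing_clopens:
  assumes "closed (F :: cantor set)"
  obtains D :: "nat \<Rightarrow> cantor set" where "\<And>n. D n \<in> Omega" "decseq D" "(\<Inter>n. D n) = F"
proof -
  obtain D :: "nat \<Rightarrow> cantor set" where D: "\<And>n. D n \<in> Omega" "incseq D" "(\<Union>n. D n) = - F"
    using open_eq_increasing_clopens[of "- F"] assms by (auto simp: closed_def)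
  show ?thesis
  proof
    show "- D n \<in> Omega" for n
      using D(1)[of n] by (auto simp: Omega_def)
    show "decseq (\<lambda>n. - D n)"
      using D(2) by (auto simp: decseq_def incseq_def)
    show "(\<Inter>n. - D n) = F"
      using D(3) by auto
  qed
qed

section \<open>Outer approximation of null sets\<close>

lemma closed_null_subset_clopen:
  assumes "closed F" "F \<in> null_sets cantor_measure" "0 < (e :: real)"
  obtains D where "D \<in> Omega" "F \<subseteq> D" "measure cantor_measure D < e"
proof -
  interpret prob_space cantor_measure
    by (rule prob_space_cantor_measure)
  obtain D :: "nat \<Rightarrow> cantor set" where D: "\<And>n. D n \<in> Omega" "decseq D" "(\<Inter>n. D n) = F"
    using closed_eq_decreasing_clopens[OF assms(1)] by blast
  \<comment> \<open>Continuity from above along the clopen sets shrinking to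
    \<open>F\<close>.\<close>
  have "(\<lambda>n. measure cantor_measure (D n)) \<longlonglongrightarrow> measure cantor_measure F"
    using finite_Lim_measure_decseq[of D] D Omega_sets by auto
  moreover have "measure cantor_measure F = 0"
    using assms(2) by (simp add: measure_eq_emeasure_eq_ennreal null_setsD1)
  ultimately have "\<forall>\<^sub>F n in sequentially. measure cantor_measure (D n) < e"
    using assms(3) order_tendstoD(2) by metis
  then obtain n where "measure cantor_measure (D n) < e"
    by (auto simp: eventually_sequentially)
  then show ?thesis
    using that D by blast
qed

text \<open>Outer regularity is transported from the Polish space \<open>nat \<Rightarrow> real\<close>, in which
  \<^typ>\<open>cantor\<close> embeds continuously with a Borel left inverse.\<close>

lemma null_subset_open:
  assumes "X \<in> null_sets cantor_measure" "0 < (e :: ennreal)"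
  obtains U where "open U" "X \<subseteq> U" "emeasure cantor_measure U < e"
proof -
  interpret prob_space cantor_measure
    by (rule prob_space_cantor_measure)
  define g :: "cantor \<Rightarrow> nat \<Rightarrow> real" where "g = (\<lambda>x n. of_bool (x n))"
  define h :: "(nat \<Rightarrow> real) \<Rightarrow> cantor" where "h = (\<lambda>y n. y n > 1 / 2)"
  have hg: "h (g x) = x" for x
    by (auto simp: h_def g_def)
  have "continuous_on UNIV (\<lambda>b :: bool. of_bool b :: real)"
    by (simp add: continuous_on_open_vimage discrete_topology_class.open_discrete)
  then have "continuous_on UNIV (\<lambda>x. g x n)" for n
    unfolding g_def
    by (rule continuous_on_compose2[OF _ continuous_on_product_coordinates]) auto
  then have cont: "continuous_on UNIV g"
    by (intro continuous_on_coordinatewise_then_product)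
  then have g: "g \<in> measurable cantor_measure borel"
    using borel_measurable_continuous_onI sets_cantor_measure measurable_cong_sets by blast
  have "h \<in> measurable borel (\<Pi>\<^sub>M n\<in>UNIV. borel)"
    unfolding h_def
  proof (rule measurable_PiM_single')
    show "(\<lambda>y :: nat \<Rightarrow> real. y n > 1 / 2) \<in> measurable borel borel" for n :: nat
    proof -
      have "{y :: nat \<Rightarrow> real. y n > 1 / 2} \<in> sets borel"
        by (intro borel_open open_Collect_less continuous_intros) auto
      then have "(\<lambda>y :: nat \<Rightarrow> real. y n > 1 / 2) \<in> measurable borel (count_space UNIV)"
        by (simp add: pred_def)
      then show ?thesis
        by (rule measurable_compose) auto
    qed
  qed auto
  then have h: "h \<in> measurable borel borel"
    using sets_PiM_equal_borel measurable_cong_sets by blast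
  have X: "X \<in> sets borel" "emeasure cantor_measure X = 0"
    using assms(1) by (auto simp: sets_cantor_measure null_sets_def)
  let ?M = "distr cantor_measure borel g"
  have Y: "h -` X \<in> sets borel"
    using measurable_sets[OF h X(1)] by simp
  have sp: "space cantor_measure = UNIV"
    using sets_eq_imp_space_eq[OF sets_cantor_measure] by simp
  \<comment> \<open>Since \<open>h\<close> undoes \<open>g\<close>, pulling the set back along
    \<open>g\<close> returns \<open>X\<close>, so it is null for the image measure.\<close>
  have "emeasure ?M (h -` X) = 0"
    using X(2) by (subst emeasure_distr[OF g Y]) (simp add: vimage_def hg sp)
  moreover have "emeasure ?M (space ?M) \<noteq> \<infinity>"
    using g by (simp add: emeasure_distr sp emeasure_eq_measure)
  ultimately have "(INF V \<in> {V. h -` X \<subseteq> V \<and> open V}. emeasure ?M V) < e"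
    using outer_regular[of ?M "h -` X"] Y assms(2) by simp
  then obtain V where V: "h -` X \<subseteq> V" "open V" "emeasure ?M V < e"
    by (auto simp: INF_less_iff)
  show ?thesis
  proof
    show "open (g -` V)"
      using cont V(2) by (simp add: continuous_on_open_vimage)
    show "X \<subseteq> g -` V"
      using V(1) hg by auto
    show "emeasure cantor_measure (g -` V) < e"
      using V(2,3) by (simp add: emeasure_distr[OF g] sp)
  qed
qed

section \<open>Null sets inside limsups of clopen sequences\<close>

lemma Omega_bar_if_summable:
  assumes "\<And>n. c n \<in> Omega" "(\<Sum>n. emeasure cantor_measure (c n)) < \<infinity>"
  shows "c \<in> Omega_bar"
proof -
  interpret prob_space cantor_measure
    by (rule prob_space_cantor_measure)
  have "summable (\<lambda>n. measure cantor_measure (c n))"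
    using assms(2) by (intro summable_suminf_not_top) (auto simp: emeasure_eq_measure)
  then have "limsup c \<in> null_sets cantor_measure"
    using assms(1) by (intro borel_cantelli_limsup1) (auto simp: Omega_sets emeasure_eq_measure)
  moreover have "limsup c = N_inf c"
    by (auto simp: limsup_INF_SUP N_inf_def infinite_nat_iff_unbounded_le)
  ultimately show ?thesis
    using assms(1) by (simp add: Omega_bar_def)
qed

lemma Omega_disjointed:
  assumes "\<And>n. D n \<in> Omega"
  shows "disjointed D n \<in> Omega"
  using assms unfolding Omega_def disjointed_def by (auto intro: open_Diff closed_Diff)

text \<open>For each \<open>n\<close>, an open cover of \<open>X\<close> of measure below
  \<open>(1/2)^n\<close> is cut into clopen pieces. Listing the pieces for all \<open>n\<close> in
  one sequence keeps the measures summable, and each point of \<open>X\<close> lies in a piece from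
  every level.\<close>

lemma null_subset_N_inf:
  assumes "X \<in> null_sets cantor_measure"
  obtains c where "c \<in> Omega_bar" "X \<subseteq> N_inf c"
proof -
  have "\<exists>D. (\<forall>m. D m \<in> Omega) \<and> X \<subseteq> (\<Union>m. D m) \<and>
    (\<Sum>m. emeasure cantor_measure (D m)) \<le> ennreal ((1/2)^n)" for n :: nat
  proof -
    have "0 < ennreal ((1/2)^n)"
      by simp
    then obtain U where U: "open U" "X \<subseteq> U" "emeasure cantor_measure U < ennreal ((1/2)^n)"
      using null_subset_open[OF assms] by metis
    obtain D :: "nat \<Rightarrow> cantor set" where D: "\<And>m. D m \<in> Omega" "(\<Union>m. D m) = U"
      using open_eq_increasing_clopens[OF U(1)] by metis
    \<comment> \<open>The measures of the increasing sets \<open>D m\<close> need not be summable;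
      those of their disjoint differences add up to the measure of \<open>U\<close>.\<close>
    have "(\<Sum>m. emeasure cantor_measure (disjointed D m)) = emeasure cantor_measure U"
      using Omega_disjointed[of D] D
      by (subst suminf_emeasure)
         (auto simp: disjoint_family_disjointed UN_disjointed_eq Omega_sets)
    then show ?thesis
      using U D Omega_disjointed[of D] by (intro exI[of _ "disjointed D"]) (auto simp: UN_disjointed_eq)
  qed
  then obtain D where D: "\<And>n m. D n m \<in> Omega" "\<And>n. X \<subseteq> (\<Union>m. D n m)"
    "\<And>n. (\<Sum>m. emeasure cantor_measure (D n m)) \<le> ennreal ((1/2)^n)"
    by metis
  define c where "c = (\<lambda>k. D (fst (prod_decode k)) (snd (prod_decode k)))"
  show ?thesis
  proof
    show "c \<in> Omega_bar"
    proof (rule Omega_bar_if_summable)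
      show "c n \<in> Omega" for n
        by (simp add: c_def D)
      have "(\<Sum>k. emeasure cantor_measure (c k)) = (\<Sum>n m. emeasure cantor_measure (D n m))"
        unfolding c_def
        using suminf_ennreal_2dimen[of "\<lambda>n. \<Sum>m. emeasure cantor_measure (D n m)"
          "\<lambda>p. emeasure cantor_measure (D (fst p) (snd p))"] by simp
      also have "\<dots> \<le> (\<Sum>n. ennreal ((1/2)^n))"
        using D(3) by (intro suminf_le) auto
      also have "\<dots> < \<infinity>"
        by (simp add: suminf_ennreal2 summable_geometric)
      finally show "(\<Sum>k. emeasure cantor_measure (c k)) < \<infinity>" .
    qed
    show "X \<subseteq> N_inf c"
    proof
      fix x assume "x \<in> X"
      then have "\<exists>m. x \<in> D n m" for n
        using D(2) by auto
      then obtain m where m: "\<And>n. x \<in> D n (m n)"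
        by metis
      have "range (\<lambda>n. prod_encode (n, m n)) \<subseteq> {k. x \<in> c k}"
        using m by (auto simp: c_def)
      moreover have "infinite (range (\<lambda>n. prod_encode (n, m n)))"
        by (intro range_inj_infinite injI) simp
      ultimately show "x \<in> N_inf c"
        using finite_subset by (auto simp: N_inf_def)
    qed
  qed
qed

section \<open>Avoiding nowhere dense and meagre sets by finite patterns\<close>

lemma nowhere_dense_UN_atMost:
  assumes "\<And>i. nowhere_dense (F i)"
  shows "nowhere_dense (\<Union>i\<le>n::nat. F i)"
proof (induction n)
  case (Suc n)
  then show ?case
    using assms[of "Suc n"] interior_closed_Un_empty_interior[of "closure (F (Suc n))"]
    by (simp add: nowhere_dense_def atMost_Suc)
next
  case 0
  then show ?case
    using assms[of 0] by simp
qed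

text \<open>The stems in \<open>T\<close> are served one at a time. Each new stem only lengthens the
  pattern, so the stems served before stay served.\<close>

lemma nowhere_dense_avoid_finite:
  assumes K: "nowhere_dense K" and "finite T"
  shows "\<exists>M s. N < M \<and> (\<forall>u\<in>T. \<forall>x\<in>cyl u N. (\<forall>i\<in>{N..<M}. x i = s i) \<longrightarrow> x \<notin> K)"
  using \<open>finite T\<close>
proof induction
  case empty
  then show ?case by auto
next
  case (insert u T)
  from insert.IH obtain M s where M: "N < M"
    and s: "\<forall>u\<in>T. \<forall>x\<in>cyl u N. (\<forall>i\<in>{N..<M}. x i = s i) \<longrightarrow> x \<notin> K"
    by (elim exE conjE)
  \<comment> \<open>The new stem followed by the pattern found so far: every point of
    \<open>cyl w M\<close> still carries that pattern, and one of them is outside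
    \<open>closure K\<close>.\<close>
  define w where "w i = (if i < N then u i else s i)" for i
  have "\<not> cyl w M \<subseteq> closure K"
    using K interiorI[OF open_cyl self_in_cyl, of w M] by (auto simp: nowhere_dense_def)
  then obtain y where y: "y \<in> cyl w M" "y \<in> - closure K"
    by auto
  moreover have "open (- closure K)"
    by (intro open_Compl closed_closure)
  ultimately obtain M' where M': "cyl y M' \<subseteq> - closure K"
    using open_contains_cyl by metis
  have "x \<notin> K" if "v \<in> insert u T" "x \<in> cyl v N" and x: "\<forall>i\<in>{N..<max M M'}. x i = y i" for v x
  proof (cases "v = u")
    case True
    \<comment> \<open>Below \<open>N\<close> both points follow \<open>u\<close>; from
      \<open>N\<close> on the pattern fixes \<open>x\<close>.\<close>
    have "x i = y i" if "i < M'" for i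
      using x that y(1) \<open>x \<in> cyl v N\<close> True M by (cases "i < N") (auto simp: cyl_def w_def)
    then have "x \<in> cyl y M'"
      by (simp add: cyl_def)
    then show ?thesis
      using M' closure_subset by blast
  next
    case False
    have "x i = s i" if "i \<in> {N..<M}" for i
      using x that y(1) by (auto simp: cyl_def w_def)
    then show ?thesis
      using False that(1,2) s by simp
  qed
  then have "\<forall>v\<in>insert u T. \<forall>x\<in>cyl v N. (\<forall>i\<in>{N..<max M M'}. x i = y i) \<longrightarrow> x \<notin> K"
    by (intro ballI impI)
  moreover have "N < max M M'"
    using M by simp
  ultimately show ?case
    by (intro exI conjI)
qed

text \<open>There are only finitely many stems of length \<open>N\<close>, so one pattern serves
  them all.\<close>

lemma nowhere_dense_avoid:
  assumes "nowhere_dense (K :: cantor set)"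
  shows "\<exists>M s. N < M \<and> (\<forall>x. (\<forall>i\<in>{N..<M}. x i = s i) \<longrightarrow> x \<notin> K)"
proof -
  let ?T = "(\<lambda>a i. i \<in> a) ` Pow {..<N}"
  have T: "\<exists>u\<in>?T. x \<in> cyl u N" for x
    by (rule bexI[OF _ imageI[of "{i. i < N \<and> x i}"]]) (auto simp: cyl_def)
  have "finite ?T"
    by simp
  from nowhere_dense_avoid_finite[OF assms this, of N] obtain M s where "N < M"
    and s: "\<forall>u\<in>?T. \<forall>x\<in>cyl u N. (\<forall>i\<in>{N..<M}. x i = s i) \<longrightarrow> x \<notin> K"
    by (elim exE conjE)
  have "x \<notin> K" if "\<forall>i\<in>{N..<M}. x i = s i" for x
    using T[of x] s that by metis
  then show ?thesis
    using \<open>N < M\<close> by (intro exI[of _ M] exI[of _ s]) simp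
qed

text \<open>The pattern on block \<open>n\<close> avoids \<open>F 0\<close>, ..., \<open>F n\<close>
  at once, so infinitely many matched blocks keep \<open>x\<close> out of every \<open>F m\<close>.
  Starting the blocks at \<open>N\<close> leaves the first \<open>N\<close> coordinates
  free.\<close>

lemma meagre_avoid_blocks:
  assumes "meagre (A :: cantor set)"
  obtains f :: "nat \<Rightarrow> nat" and t :: "nat \<Rightarrow> cantor" where "strict_mono f" "f 0 = N"
    "\<And>x. \<exists>\<^sub>\<infinity>n. \<forall>i\<in>{f n..<f (Suc n)}. x i = t n i \<Longrightarrow> x \<notin> A"
proof -
  obtain F :: "nat \<Rightarrow> cantor set" where F: "\<And>n. nowhere_dense (F n)" "A = (\<Union>n. F n)"
    using assms by (auto simp: meagre_def)
  have "\<forall>n N. \<exists>M s. N < M \<and> (\<forall>x. (\<forall>i\<in>{N..<M}. x i = s i) \<longrightarrow> x \<notin> (\<Union>i\<le>n. F i))"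
    using nowhere_dense_avoid[OF nowhere_dense_UN_atMost[of F, OF F(1)]] by blast
  then obtain M s where M: "\<And>n N. N < M n N"
    and s: "\<And>n N x. \<forall>i\<in>{N..<M n N}. x i = s n N i \<Longrightarrow> x \<notin> (\<Union>i\<le>n. F i)"
    by metis
  define f where "f = rec_nat N M"
  have f: "f 0 = N" "f (Suc n) = M n (f n)" for n
    by (simp_all add: f_def)
  show ?thesis
  proof
    show "strict_mono f"
      by (simp add: strict_mono_Suc_iff f M)
    show "f 0 = N"
      by (fact f)
    fix x assume inf: "\<exists>\<^sub>\<infinity>n. \<forall>i\<in>{f n..<f (Suc n)}. x i = s n (f n) i"
    have "x \<notin> F m" for m
    proof -
      obtain n where "m \<le> n" "\<forall>i\<in>{f n..<f (Suc n)}. x i = s n (f n) i"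
        using inf by (auto simp: INFM_nat_le)
      then show ?thesis
        using s[of "f n" n x] f(2) by auto
    qed
    then show "x \<notin> A"
      by (simp add: F(2))
  qed
qed

section \<open>Blocks and ideals with the Baire property\<close>

definition block_index :: "(nat \<Rightarrow> nat) \<Rightarrow> nat \<Rightarrow> nat" where
  "block_index f i = (LEAST n. i < f (Suc n))"

lemma block_index_eq:
  assumes "strict_mono f" "i \<in> {f n..<f (Suc n)}"
  shows "block_index f i = n"
  unfolding block_index_def
proof (rule Least_equality)
  show "i < f (Suc n)"
    using assms(2) by simp
next
  fix m assume "i < f (Suc m)"
  then have "f n < f (Suc m)"
    using assms(2) by simp
  then show "n \<le> m"
    using assms(1) by (simp add: strict_mono_less)
qed

text \<open>Indices below \<open>f 0\<close> count as block 0, so the bound holds for every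
  \<open>i\<close>.\<close>

lemma less_block_index:
  assumes "strict_mono f"
  shows "i < f (Suc (block_index f i))"
  unfolding block_index_def
proof (rule LeastI)
  show "i < f (Suc i)"
    using strict_mono_imp_increasing[OF assms, of "Suc i"] by simp
qed

lemma ideal_on_omega_subset: "ideal_on_omega J \<Longrightarrow> a \<in> J \<Longrightarrow> b \<subseteq> a \<Longrightarrow> b \<in> J"
  unfolding ideal_on_omega_def by metis

lemma ideal_on_omega_Un: "ideal_on_omega J \<Longrightarrow> a \<in> J \<Longrightarrow> b \<in> J \<Longrightarrow> a \<union> b \<in> J"
  unfolding ideal_on_omega_def by metis

lemma ideal_on_omega_finite: "ideal_on_omega J \<Longrightarrow> finite a \<Longrightarrow> a \<in> J"
  by (simp add: ideal_on_omega_def)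

lemma mem_char_funs: "x \<in> char_funs J \<longleftrightarrow> {n. x n} \<in> J"
proof
  assume "x \<in> char_funs J"
  then show "{n. x n} \<in> J"
    unfolding char_funs_def by (elim imageE) simp
next
  assume "{n. x n} \<in> J"
  then show "x \<in> char_funs J"
    unfolding char_funs_def by (rule rev_image_eqI) simp
qed

text \<open>If the family were comeagre in some cylinder, that cylinder would contain two
  members of it that are complementary beyond a finite set.\<close>

lemma ideal_baire_property_imp_meagre:
  assumes J: "ideal_on_omega J" and "baire_property (char_funs J)"
  shows "meagre (char_funs J)"
proof -
  obtain U where U: "open U" and mU: "meagre (sym_diff (char_funs J) U)"
    using assms(2) by (auto simp: baire_property_def)
  \<comment> \<open>Then the symmetric difference is \<open>char_funs J\<close> itself.\<close>
  have "U = {}"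
  proof (rule ccontr)
    assume "U \<noteq> {}"
    then obtain u N where uN: "cyl u N \<subseteq> U"
      using open_contains_cyl[OF U] by blast
    obtain f t where f: "strict_mono f" "f 0 = N"
      and t: "\<And>x. \<exists>\<^sub>\<infinity>n. \<forall>i\<in>{f n..<f (Suc n)}. x i = t n i \<Longrightarrow> x \<notin> sym_diff (char_funs J) U"
      using meagre_avoid_blocks[OF mU, of N] by blast
    have ge: "N \<le> i" if "i \<in> {f n..<f (Suc n)}" for i n
      using that f(2) strict_mono_less_eq[OF f(1), of 0 n] by simp
    \<comment> \<open>Past \<open>N\<close>, \<open>x\<close> follows \<open>t\<close> on even
      blocks and its negation on odd blocks, so the complement \<open>y\<close> follows
      \<open>t\<close> on odd blocks. Both begin with \<open>u\<close>, hence lie in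
      \<open>U\<close>, and both avoid the meagre difference.\<close>
    define x where "x i = (if i < N then u i
      else if even (block_index f i) then t (block_index f i) i else \<not> t (block_index f i) i)" for i
    define y where "y i = (if i < N then u i else \<not> x i)" for i
    have "\<forall>i\<in>{f (2 * n)..<f (Suc (2 * n))}. x i = t (2 * n) i" for n
    proof
      fix i assume i: "i \<in> {f (2 * n)..<f (Suc (2 * n))}"
      show "x i = t (2 * n) i"
        using ge[OF i] by (simp add: x_def block_index_eq[OF f(1) i])
    qed
    then have "\<exists>\<^sub>\<infinity>n. \<forall>i\<in>{f n..<f (Suc n)}. x i = t n i"
      unfolding INFM_nat_le by (metis le_add2 mult_2)
    then have "x \<notin> sym_diff (char_funs J) U"
      by (rule t)
    moreover have "x \<in> U"
      using uN by (auto simp: cyl_def x_def)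
    ultimately have xJ: "{n. x n} \<in> J"
      by (simp add: mem_char_funs)
    have "\<forall>i\<in>{f (Suc (2 * n))..<f (Suc (Suc (2 * n)))}. y i = t (Suc (2 * n)) i" for n
    proof
      fix i assume i: "i \<in> {f (Suc (2 * n))..<f (Suc (Suc (2 * n)))}"
      show "y i = t (Suc (2 * n)) i"
        using ge[OF i] by (simp add: x_def y_def block_index_eq[OF f(1) i])
    qed
    then have "\<exists>\<^sub>\<infinity>n. \<forall>i\<in>{f n..<f (Suc n)}. y i = t n i"
      unfolding INFM_nat_le by (metis le_SucI le_add2 mult_2)
    then have "y \<notin> sym_diff (char_funs J) U"
      by (rule t)
    moreover have "y \<in> U"
      using uN by (auto simp: cyl_def y_def)
    ultimately have yJ: "{n. y n} \<in> J"
      by (simp add: mem_char_funs)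
    \<comment> \<open>The two members of \<open>J\<close> cover everything except possibly indices
      below \<open>N\<close>.\<close>
    have "{..<N} \<in> J"
      using J by (simp add: ideal_on_omega_finite)
    then have "{..<N} \<union> ({n. x n} \<union> {n. y n}) \<in> J"
      using J xJ yJ by (intro ideal_on_omega_Un)
    moreover have "{..<N} \<union> ({n. x n} \<union> {n. y n}) = UNIV"
      by (auto simp: y_def)
    ultimately show False
      using J by (simp add: ideal_on_omega_def)
  qed
  then show ?thesis
    using mU by simp
qed

text \<open>If a member of \<open>J\<close> contained infinitely many blocks, keeping only its
  elements selected by \<open>t\<close> would give a subset matching the pattern on all those
  blocks, hence outside \<open>J\<close>.\<close>

theorem talagrand_blocks:
  assumes J: "ideal_on_omega J" and "baire_property (char_funs J)"
  obtains f :: "nat \<Rightarrow> nat" where "strict_mono f" "f 0 = 0"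
    "\<And>a. \<exists>\<^sub>\<infinity>n. {f n..<f (Suc n)} \<subseteq> a \<Longrightarrow> a \<notin> J"
proof -
  obtain f :: "nat \<Rightarrow> nat" and t where f: "strict_mono f" "f 0 = 0"
    and t: "\<And>x. \<exists>\<^sub>\<infinity>n. \<forall>i\<in>{f n..<f (Suc n)}. x i = t n i \<Longrightarrow> x \<notin> char_funs J"
    using meagre_avoid_blocks[OF ideal_baire_property_imp_meagre[OF assms], of 0] by blast
  have "a \<notin> J" if inf: "\<exists>\<^sub>\<infinity>n. {f n..<f (Suc n)} \<subseteq> a" for a
  proof
    assume "a \<in> J"
    define x where "x i \<longleftrightarrow> i \<in> a \<and> t (block_index f i) i" for i
    have "\<exists>\<^sub>\<infinity>n. \<forall>i\<in>{f n..<f (Suc n)}. x i = t n i"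
      using inf
    proof (rule INFM_mono)
      fix n assume "{f n..<f (Suc n)} \<subseteq> a"
      then show "\<forall>i\<in>{f n..<f (Suc n)}. x i = t n i"
        using block_index_eq[OF f(1)] by (auto simp: x_def)
    qed
    then have "{i. x i} \<notin> J"
      using t by (simp add: mem_char_funs)
    moreover have "{i. x i} \<subseteq> a"
      by (auto simp: x_def)
    ultimately show False
      using J \<open>a \<in> J\<close> ideal_on_omega_subset by blast
  qed
  then show ?thesis
    using that f by blast
qed

section \<open>The equality for \<open>null_mod J\<close>\<close>

lemma null_mod_eq:
  assumes J: "ideal_on_omega J" and BP: "baire_property (char_funs J)"
  shows "null_mod J = null_ideal"
proof (intro equalityI subsetI)
  fix X assume "X \<in> null_mod J"
  then obtain c where c: "c \<in> Omega_bar" "X \<subseteq> N_pos J c"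
    by (auto simp: null_mod_def)
  have "N_pos J c \<subseteq> N_inf c"
    using J by (auto simp: N_pos_def N_inf_def positive_sets_def ideal_on_omega_finite)
  then show "X \<in> null_ideal"
    using c unfolding null_ideal_def null_sets_completion_iff2 Omega_bar_def by blast
next
  fix X assume "X \<in> null_ideal"
  then obtain c where c: "c \<in> Omega_bar" "X \<subseteq> N_inf c"
    unfolding null_ideal_def null_sets_completion_iff2 using null_subset_N_inf by (metis order_trans)
  obtain f :: "nat \<Rightarrow> nat" where f: "strict_mono f"
    and pos: "\<And>a. \<exists>\<^sub>\<infinity>n. {f n..<f (Suc n)} \<subseteq> a \<Longrightarrow> a \<notin> J"
    using talagrand_blocks[OF assms] by blast
  define d where "d k = c (block_index f k)" for k
  have "N_inf d \<subseteq> N_inf c"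
  proof
    fix x assume "x \<in> N_inf d"
    \<comment> \<open>Each \<open>n\<close> is repeated at only finitely many places
      \<open>k\<close>, all below \<open>f (Suc n)\<close>.\<close>
    have "{k. x \<in> d k} \<subseteq> (\<Union>n\<in>{n. x \<in> c n}. {..<f (Suc n)})"
      using less_block_index[OF f] by (auto simp: d_def)
    then have "finite {n. x \<in> c n} \<Longrightarrow> finite {k. x \<in> d k}"
      by (rule finite_subset) simp
    then show "x \<in> N_inf c"
      using \<open>x \<in> N_inf d\<close> by (auto simp: N_inf_def)
  qed
  moreover have "N_inf c \<subseteq> N_pos J d"
  proof
    fix x assume "x \<in> N_inf c"
    then have "\<exists>\<^sub>\<infinity>n. x \<in> c n"
      by (simp add: N_inf_def frequently_cofinite)
    then have "\<exists>\<^sub>\<infinity>n. {f n..<f (Suc n)} \<subseteq> {k. x \<in> d k}"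
      by (rule INFM_mono) (auto simp: d_def block_index_eq[OF f])
    then show "x \<in> N_pos J d"
      using pos by (simp add: N_pos_def positive_sets_def)
  qed
  moreover have "N_pos J d \<subseteq> N_inf d"
    using J by (auto simp: N_pos_def N_inf_def positive_sets_def ideal_on_omega_finite)
  \<comment> \<open>The three inclusions close a cycle, so \<open>N_inf d\<close> is the same null
    set and \<open>d\<close> is admissible.\<close>
  ultimately have "N_inf d = N_inf c" "X \<subseteq> N_pos J d"
    using c(2) by auto
  moreover from this have "d \<in> Omega_bar"
    using c(1) by (auto simp: Omega_bar_def d_def)
  ultimately show "X \<in> null_mod J"
    by (auto simp: null_mod_def)
qed

section \<open>Countable covers by closed null sets\<close>

lemma closed_null_ideal_iff:
  "X \<in> closed_null_ideal \<longleftrightarrow>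
     (\<exists>F :: nat \<Rightarrow> cantor set. (\<forall>n. closed (F n) \<and> F n \<in> null_sets cantor_measure) \<and> X \<subseteq> (\<Union>n. F n))"
    (is "_ \<longleftrightarrow> ?P X")
proof -
  \<comment> \<open>Closed sets are Borel, so the completion adds no closed null sets.\<close>
  have G: "closed F \<and> F \<in> null_ideal \<longleftrightarrow> closed F \<and> F \<in> null_sets cantor_measure" for F
    by (auto simp: null_ideal_def null_sets_completion_iff sets_cantor_measure)
  \<comment> \<open>The sets with such a cover form a sigma-ideal containing the generators, and
    every such sigma-ideal contains them all; hence they form the least one.\<close>
  have "sigma_ideal {X. ?P X}"
    unfolding sigma_ideal_def
  proof (intro conjI allI impI)
    fix A B assume "A \<in> {X. ?P X}" "B \<subseteq> A"
    then show "B \<in> {X. ?P X}" by blast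
  next
    fix S assume S: "S \<subseteq> {X. ?P X}" "countable S"
    show "\<Union>S \<in> {X. ?P X}"
    proof (cases "S = {}")
      case True
      then show ?thesis by (auto intro!: exI[of _ "\<lambda>_. {}"])
    next
      case False
      then obtain A :: "nat \<Rightarrow> cantor set" where A: "S = range A"
        using S(2) uncountable_def by metis
      then have "\<forall>n. ?P (A n)"
        using S(1) by auto
      then obtain F :: "nat \<Rightarrow> nat \<Rightarrow> cantor set"
        where F: "\<And>n m. closed (F n m) \<and> F n m \<in> null_sets cantor_measure" "\<And>n. A n \<subseteq> (\<Union>m. F n m)"
        by metis
      \<comment> \<open>Pairing merges the countably many covers into one sequence.\<close>
      define H where "H k = F (fst (prod_decode k)) (snd (prod_decode k))" for k
      have "F n m \<subseteq> (\<Union>k. H k)" for n m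
        using UN_upper[of "prod_encode (n, m)" UNIV H] by (simp add: H_def)
      then have "(\<Union>m. F n m) \<subseteq> (\<Union>k. H k)" for n
        by (intro UN_least)
      then have "A n \<subseteq> (\<Union>k. H k)" for n
        using F(2) by (rule order_trans[rotated])
      then have "\<Union>S \<subseteq> (\<Union>k. H k)"
        unfolding A by (rule UN_least)
      moreover have "\<forall>k. closed (H k) \<and> H k \<in> null_sets cantor_measure"
        using F(1) by (simp add: H_def)
      ultimately show ?thesis
        by (intro CollectI exI[of _ H] conjI)
    qed
  qed
  moreover have "{X. closed X \<and> X \<in> null_ideal} \<subseteq> {X. ?P X}"
  proof
    fix X assume "X \<in> {X. closed X \<and> X \<in> null_ideal}"
    then show "X \<in> {X. ?P X}"
      using G by (intro CollectI exI[of _ "\<lambda>_. X"]) auto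
  qed
  ultimately have "closed_null_ideal \<subseteq> {X. ?P X}"
    unfolding closed_null_ideal_def sigma_ideal_generated_def by (intro Inter_lower CollectI conjI)
  then have "X \<in> closed_null_ideal \<Longrightarrow> ?P X"
    by (rule CollectD[OF subsetD])
  moreover have "X \<in> closed_null_ideal" if P: "?P X"
    unfolding closed_null_ideal_def sigma_ideal_generated_def
  proof (rule InterI)
    fix I assume "I \<in> {I. sigma_ideal I \<and> {X. closed X \<and> X \<in> null_ideal} \<subseteq> I}"
    then have I: "sigma_ideal I" "{X. closed X \<and> X \<in> null_ideal} \<subseteq> I"
      by auto
    obtain F :: "nat \<Rightarrow> cantor set" where F: "\<And>n. closed (F n) \<and> F n \<in> null_sets cantor_measure"
      "X \<subseteq> (\<Union>n. F n)"
      using P by auto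
    have "range F \<subseteq> I"
      using F(1) I(2) G by (auto intro!: subsetD[OF I(2)])
    then have "\<Union>(range F) \<in> I"
      using I(1) by (simp add: sigma_ideal_def)
    then show "X \<in> I"
      using I(1) F(2) unfolding sigma_ideal_def by metis
  qed
  ultimately show ?thesis
    by (rule iffI)
qed

section \<open>The equality for \<open>null_star_mod J\<close>\<close>

lemma mem_dual_filter: "a \<in> dual_filter J \<longleftrightarrow> - a \<in> J"
proof
  assume "- a \<in> J"
  then show "a \<in> dual_filter J"
    unfolding dual_filter_def by (intro CollectI exI[of _ "- a"]) simp
qed (auto simp: dual_filter_def)

lemma null_star_mod_subset_closed_null_ideal:
  assumes J: "ideal_on_omega J" and BP: "baire_property (char_funs J)"
  shows "null_star_mod J \<subseteq> closed_null_ideal"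
proof
  fix X assume "X \<in> null_star_mod J"
  then obtain c where c: "c \<in> Omega_bar" "X \<subseteq> N_dual J c"
    by (auto simp: null_star_mod_def)
  obtain f :: "nat \<Rightarrow> nat" where f: "strict_mono f"
    and pos: "\<And>a. \<exists>\<^sub>\<infinity>n. {f n..<f (Suc n)} \<subseteq> a \<Longrightarrow> a \<notin> J"
    using talagrand_blocks[OF assms] by blast
  \<comment> \<open>Blocks are finite, so each union is closed, and so is the intersection.\<close>
  define F where "F m = (\<Inter>n\<in>{m..}. \<Union>k\<in>{f n..<f (Suc n)}. c k)" for m
  have "closed (c k)" for k
    using c(1) by (auto simp: Omega_bar_def Omega_def)
  then have cl: "closed (F m)" for m
    unfolding F_def by (intro closed_INT ballI closed_UN) auto
  have "F m \<subseteq> N_inf c" for m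
  proof
    fix x assume x: "x \<in> F m"
    \<comment> \<open>Block \<open>max l m\<close> supplies such a \<open>k\<close>: it comes late
      enough for \<open>F m\<close>, and lies beyond \<open>l\<close> because
      \<open>f n >= n\<close>.\<close>
    have "\<exists>k\<ge>l. x \<in> c k" for l
    proof -
      have "x \<in> (\<Union>k\<in>{f (max l m)..<f (Suc (max l m))}. c k)"
        using x by (simp add: F_def)
      then obtain k where k: "k \<in> {f (max l m)..<f (Suc (max l m))}" "x \<in> c k"
        by (rule UN_E)
      have "l \<le> f (max l m)"
        using strict_mono_imp_increasing[OF f, of "max l m"] by simp
      with k(1) have "l \<le> k"
        by simp
      with k(2) show ?thesis
        by (intro exI[of _ k] conjI)
    qed
    then show "x \<in> N_inf c"
      by (auto simp: N_inf_def infinite_nat_iff_unbounded_le)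
  qed
  then have "F m \<in> null_sets cantor_measure" for m
    using c(1) cl[of m] null_sets_subset[of "N_inf c" cantor_measure "F m"]
    by (auto simp: Omega_bar_def sets_cantor_measure)
  moreover have "X \<subseteq> (\<Union>m. F m)"
  proof
    fix x assume "x \<in> X"
    then have "- {k. x \<in> c k} \<in> J"
      using c(2) by (auto simp: N_dual_def mem_dual_filter)
    \<comment> \<open>A member of \<open>J\<close> contains only finitely many blocks, so from some
      block on each one has a \<open>k\<close> with \<open>x\<close> in \<open>c k\<close>.\<close>
    then have "\<not> (\<exists>\<^sub>\<infinity>n. {f n..<f (Suc n)} \<subseteq> - {k. x \<in> c k})"
      using pos by blast
    then obtain m where "\<And>n. m \<le> n \<Longrightarrow> \<not> {f n..<f (Suc n)} \<subseteq> - {k. x \<in> c k}"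
      by (auto simp: INFM_nat_le)
    then have "x \<in> F m"
      by (simp add: F_def subset_iff Bex_def conj_assoc)
    then show "x \<in> (\<Union>m. F m)"
      by (rule UN_I[OF UNIV_I])
  qed
  ultimately show "X \<in> closed_null_ideal"
    unfolding closed_null_ideal_iff using cl by (intro exI[of _ F]) simp
qed

text \<open>Enclosing the unions of \<open>F 0\<close>, ..., \<open>F n\<close> puts a point of
  \<open>F m\<close> into every \<open>c n\<close> with \<open>n >= m\<close>, and cofinite sets
  belong to the dual filter.\<close>

lemma closed_null_ideal_subset_null_star_mod:
  assumes J: "ideal_on_omega J"
  shows "closed_null_ideal \<subseteq> null_star_mod J"
proof
  fix X assume "X \<in> closed_null_ideal"
  then obtain F :: "nat \<Rightarrow> cantor set"
    where F: "\<And>n. closed (F n)" "\<And>n. F n \<in> null_sets cantor_measure" "X \<subseteq> (\<Union>n. F n)"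
    by (auto simp: closed_null_ideal_iff)
  interpret prob_space cantor_measure
    by (rule prob_space_cantor_measure)
  have "\<exists>D. D \<in> Omega \<and> (\<Union>i\<le>n. F i) \<subseteq> D \<and> measure cantor_measure D < (1/2)^n" for n :: nat
  proof -
    have "closed (\<Union>i\<le>n. F i)" "(\<Union>i\<le>n. F i) \<in> null_sets cantor_measure"
      using F(1,2) by (auto intro!: null_sets.finite_UN)
    moreover have "0 < (1/2 :: real)^n"
      by simp
    ultimately show ?thesis
      using closed_null_subset_clopen by metis
  qed
  then obtain c where c: "\<And>n. c n \<in> Omega" "\<And>n. (\<Union>i\<le>n. F i) \<subseteq> c n"
    "\<And>n. measure cantor_measure (c n) < (1/2)^n"
    by metis
  have "(\<Sum>n. emeasure cantor_measure (c n)) \<le> (\<Sum>n. ennreal ((1/2)^n))"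
    using c(3) by (intro suminf_le) (auto simp: emeasure_eq_measure less_imp_le)
  also have "\<dots> < \<infinity>"
    by (simp add: suminf_ennreal2 summable_geometric)
  finally have "c \<in> Omega_bar"
    by (intro Omega_bar_if_summable c)
  moreover have "X \<subseteq> N_dual J c"
  proof
    fix x assume "x \<in> X"
    then obtain m where "x \<in> F m"
      using F(3) by auto
    then have "x \<in> c n" if "m \<le> n" for n
      using c(2)[of n] that by auto
    then have "- {n. x \<in> c n} \<subseteq> {..<m}"
      by (auto simp: not_le[symmetric])
    then have "finite (- {n. x \<in> c n})"
      by (rule finite_subset) simp
    then show "x \<in> N_dual J c"
      using J by (simp add: N_dual_def mem_dual_filter ideal_on_omega_finite)
  qed
  ultimately show "X \<in> null_star_mod J"
    by (auto simp: null_star_mod_def)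
qed

theorem theorem2p18:
  fixes J :: "nat set set"
  assumes "ideal_on_omega J"
    and "baire_property (char_funs J)"
  shows "null_mod J = null_ideal \<and> null_star_mod J = closed_null_ideal"
  by (intro conjI null_mod_eq equalityI null_star_mod_subset_closed_null_ideal
      closed_null_ideal_subset_null_star_mod assms)

end
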